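(* For any integer $n\geq 0$, $$\sum_{k=2}^{\infty}\frac{\zeta(k)\,k^{n}}{2^{k}}=\log 2+\sum_{k=1}^{n}\genfrac{\{}{\}}{0pt}{}{n+1}{k+1}k!\left(1-2^{-k-1}\right)\zeta(k+1).$$
   Context: $\zeta$ is the Riemann zeta function and $\genfrac{\{}{\}}{0pt}{}{n}{k}$ denotes the Stirling numbers of the second kind. *)

theory Defs
  imports "HOL-Analysis.Analysis" "HOL-Combinatorics.Stirling"
begin

text \<open>
  The Riemann zeta function on the real half-line \<open>s > 1\<close>, given there by its Dirichlet series
  \<open>1 + 1 / 2 powr s + 1 / 3 powr s + \<dots>\<close>.  For \<open>s \<le> 1\<close> the series diverges, and this function
  does not represent the analytic continuation.
\<close>

definition zeta :: "real \<Rightarrow> real" where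
  "zeta s = (\<Sum>m. 1 / real (Suc m) powr s)"

end

theory Submission
  imports Defs
begin

text \<open>
  Insert the Dirichlet series of zeta and exchange the two sums.  For \<open>x = 1 / (2 m)\<close> the inner
  sum of \<open>k ^ n x ^ k\<close> over \<open>k \<ge> 1\<close> is a polynomial in \<open>x / (1 - x) = 1 / (2 m - 1)\<close> whose
  coefficients are \<open>Stirling (n + 1) (j + 1) * fact j\<close>.  Summing over \<open>m\<close>, the linear term minus
  the missing \<open>k = 1\<close> term gives the alternating harmonic series, and the higher powers give zeta
  values restricted to odd integers.
\<close>

text \<open>Induction on \<open>n\<close>: multiplying \<open>i choose j\<close> by
  \<open>Suc i\<close> gives \<open>Suc j\<close> times the sum of \<open>i choose j\<close> and
  \<open>i choose Suc j\<close>, and collecting coefficients reproduces the Stirling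
  recurrence.\<close>

lemma power_Suc_eq_sum_Stirling_binomial:
  "Suc i ^ n = (\<Sum>j\<le>n. Stirling (Suc n) (Suc j) * fact j * (i choose j))"
proof (induction n)
  case 0
  then show ?case by simp
next
  case (Suc n)
  let ?S = "\<lambda>j. Stirling (Suc n) (Suc j)"
  have step: "Suc i * (fact j * (i choose j)) =
      Suc j * fact j * (i choose j) + fact (Suc j) * (i choose Suc j)" for j
    using Suc_times_binomial_eq[of i j] by (simp add: algebra_simps)
  have "Suc i ^ Suc n = (\<Sum>j\<le>n. ?S j * (Suc i * (fact j * (i choose j))))"
    unfolding power_Suc Suc.IH sum_distrib_left by (simp only: mult_ac)
  also have "\<dots> = (\<Sum>j\<le>n. Suc j * ?S j * fact j * (i choose j))
      + (\<Sum>j\<le>n. ?S j * fact (Suc j) * (i choose Suc j))"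
    unfolding step by (simp only: distrib_left sum.distrib mult_ac)
  \<comment> \<open>The added top term vanishes, since \<open>Stirling (Suc n) (Suc (Suc n))\<close>
    is 0. In the next step the shifted sum gains a term at 0, which vanishes because
    \<open>Stirling (Suc n) 0\<close> is 0.\<close>
  also have "(\<Sum>j\<le>n. Suc j * ?S j * fact j * (i choose j)) =
      (\<Sum>j\<le>Suc n. Suc j * ?S j * fact j * (i choose j))"
    by (simp add: Stirling_less del: Stirling.simps)
  also have "(\<Sum>j\<le>n. ?S j * fact (Suc j) * (i choose Suc j)) =
      (\<Sum>j\<le>Suc n. Stirling (Suc n) j * fact j * (i choose j))"
    unfolding sum.atMost_Suc_shift by simp
  also have "(\<Sum>j\<le>Suc n. Suc j * ?S j * fact j * (i choose j)) + \<dots> =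
      (\<Sum>j\<le>Suc n. Stirling (Suc (Suc n)) (Suc j) * fact j * (i choose j))"
    unfolding sum.distrib[symmetric] Stirling.simps(4)[of "Suc n"]
    by (simp only: distrib_right)
  finally show ?case .
qed

text \<open>Induction on \<open>j\<close>: the Cauchy product with the geometric series turns the
  coefficients into partial sums of a column of Pascal's triangle, which the hockey-stick identity
  evaluates.\<close>

lemma sums_binomial_power:
  fixes x :: real
  assumes "0 \<le> x" "x < 1"
  shows "(\<lambda>i. (i choose j) * x ^ Suc i) sums (x / (1 - x)) ^ Suc j"
proof (induction j)
  case 0
  show ?case
    using sums_mult[OF geometric_sums[of x], of x] assms by simp
next
  case (Suc j)
  let ?y = "x / (1 - x)"
  have geo: "(\<lambda>i. x ^ i) sums (1 / (1 - x))"
    using geometric_sums[of x] assms by simp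
  have abs1: "summable (\<lambda>i. norm ((i choose j) * x ^ Suc i))"
    using sums_summable[OF Suc.IH] assms by (simp add: abs_mult)
  have abs2: "summable (\<lambda>i. norm (x ^ i))"
    using sums_summable[OF geo] assms by simp
  have "(\<lambda>k. \<Sum>i\<le>k. ((i choose j) * x ^ Suc i) * x ^ (k - i)) sums (?y ^ Suc j * (1 / (1 - x)))"
    using Cauchy_product_sums[OF abs1 abs2] Suc.IH geo by (simp only: sums_iff)
  moreover have "(\<Sum>i\<le>k. ((i choose j) * x ^ Suc i) * x ^ (k - i)) = (Suc k choose Suc j) * x ^ Suc k" for k
  proof -
    have "(\<Sum>i\<le>k. ((i choose j) * x ^ Suc i) * x ^ (k - i)) = (\<Sum>i\<le>k. real (i choose j) * x ^ Suc k)"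
      by (intro sum.cong) (auto simp: power_add[symmetric] mult.assoc)
    also have "\<dots> = real (\<Sum>i\<le>k. i choose j) * x ^ Suc k"
      by (simp add: sum_distrib_right)
    also have "(\<Sum>i\<le>k. i choose j) = Suc k choose Suc j"
      using sum_choose_upper[of j k] by (simp add: atMost_atLeast0)
    finally show ?thesis .
  qed
  ultimately have "(\<lambda>k. (Suc k choose Suc j) * x ^ Suc k) sums (?y ^ Suc j * (1 / (1 - x)))"
    by simp
  from sums_mult[OF this, of x]
  have "(\<lambda>k. (Suc k choose Suc j) * x ^ Suc (Suc k)) sums (?y ^ Suc (Suc j))"
    by (simp add: mult_ac)
  \<comment> \<open>Prepending the term at index 0 does not change the sum, as
    \<open>0 choose Suc j\<close> is 0.\<close>
  then show ?case
    using sums_Suc[of "\<lambda>k. real (k choose Suc j) * x ^ Suc k"] by simp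
qed

lemma sums_power_times_geometric:
  fixes x :: real
  assumes "0 \<le> x" "x < 1"
  shows "(\<lambda>i. real (Suc i) ^ n * x ^ Suc i) sums
    (\<Sum>j\<le>n. real (Stirling (Suc n) (Suc j)) * fact j * (x / (1 - x)) ^ Suc j)"
proof -
  have "real (Suc i) ^ n * x ^ Suc i =
      (\<Sum>j\<le>n. real (Stirling (Suc n) (Suc j)) * fact j * ((i choose j) * x ^ Suc i))" for i
  proof -
    have "real (Suc i) ^ n = real (\<Sum>j\<le>n. Stirling (Suc n) (Suc j) * fact j * (i choose j))"
      unfolding power_Suc_eq_sum_Stirling_binomial[symmetric] by simp
    then show ?thesis
      by (simp add: sum_distrib_right sum_distrib_left mult_ac del: Stirling.simps)
  qed
  then show ?thesis
    by (simp only:) (intro sums_sum sums_mult sums_binomial_power assms)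
qed

lemma zeta_of_nat_sums:
  assumes "k \<ge> 2"
  shows "(\<lambda>m. 1 / real (Suc m) ^ k) sums zeta (real k)"
proof -
  have "summable (\<lambda>m. 1 / real (Suc m) ^ k)"
    using inverse_power_summable[OF assms, where 'a = real]
    by (subst (asm) summable_Suc_iff[symmetric]) (simp add: field_simps)
  then show ?thesis
    by (simp add: zeta_def powr_realpow sums_iff del: of_nat_Suc)
qed

text \<open>Pairing consecutive terms of the zeta series splits it into odd and even denominators;
  the even ones contribute \<open>1 / 2 ^ k\<close> times the whole.\<close>

lemma odd_zeta_sums:
  assumes "k \<ge> 2"
  shows "(\<lambda>m. (1 / (2 * real m + 1)) ^ k) sums ((1 - 1 / 2 ^ k) * zeta (real k))"
proof -
  note z = zeta_of_nat_sums[OF assms]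
  have "(\<lambda>m. (1 / (2 * real m + 1)) ^ k + (1 / (2 * real m + 2)) ^ k) sums zeta (real k)"
    using sums_group[OF z, of 2]
    by (simp add: eval_nat_numeral power_one_over add_ac mult_ac)
  moreover have "(\<lambda>m. (1 / (2 * real m + 2)) ^ k) sums (1 / 2 ^ k * zeta (real k))"
    using sums_mult[OF z, of "1 / 2 ^ k"]
    by (simp add: power_one_over power_mult_distrib[symmetric] algebra_simps)
  ultimately show ?thesis
    using sums_diff by (fastforce simp: algebra_simps)
qed

theorem mainTheorem11:
  fixes n :: nat
  shows "(\<lambda>j. let k = j + 2 in zeta (real k) * real k ^ n / 2 ^ k) sums
    (ln 2 + (\<Sum>k=1..n. real (Stirling (n + 1) (k + 1)) * fact k
       * (1 - 1 / 2 ^ (k + 1)) * zeta (real (k + 1))))"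
proof -
  define f :: "nat \<Rightarrow> nat \<Rightarrow> real"
    where "f m j = real (j + 2) ^ n * (1 / (2 * real m + 2)) ^ (j + 2)" for m j
  define c where "c k = real (Stirling (n + 1) (k + 1)) * fact k" for k
  \<comment> \<open>The first fraction is the lowest Stirling term, with \<open>c 0 = 1\<close>; the
    subtracted one is the \<open>k = 1\<close> term of the power series, absent from the theorem's
    sum.\<close>
  define R where "R m = (1 / (2 * real m + 1) - 1 / (2 * real m + 2))
    + (\<Sum>k=1..n. c k * (1 / (2 * real m + 1)) ^ (k + 1))" for m
  define s where "s = ln 2 + (\<Sum>k=1..n. c k * ((1 - 1 / 2 ^ (k + 1)) * zeta (real (k + 1))))"
  have row: "f m sums R m" for m
  proof -
    define x where "x = 1 / (2 * real m + 2)"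
    have x: "0 \<le> x" "x < 1" "x / (1 - x) = 1 / (2 * real m + 1)"
      by (auto simp: x_def field_simps)
    have "(\<Sum>j\<le>n. c j * (x / (1 - x)) ^ Suc j) = R m + x"
      unfolding R_def x(3)
      by (simp add: atMost_atLeast0 sum.atLeast_Suc_atMost c_def x_def del: Stirling.simps)
    then have "(\<lambda>i. real (Suc i) ^ n * x ^ Suc i) sums (R m + x)"
      using sums_power_times_geometric[OF x(1,2), of n] by (simp add: c_def)
    \<comment> \<open>The dropped term at \<open>i = 0\<close> is \<open>1 ^ n * x = x\<close>,
      which cancels the \<open>x\<close> added to \<open>R m\<close>.\<close>
    from sums_split_initial_segment[OF this, of 1]
    have "(\<lambda>j. real (j + 2) ^ n * x ^ (j + 2)) sums R m"
      by simp
    then show ?thesis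
      by (simp only: f_def[abs_def] x_def)
  qed
  have col: "(\<lambda>m. f m j) sums (let k = j + 2 in zeta (real k) * real k ^ n / 2 ^ k)" for j
  proof -
    have "2 * real m + 2 = 2 * real (Suc m)" for m
      by simp
    then have "f m j = real (j + 2) ^ n / 2 ^ (j + 2) * (1 / real (Suc m) ^ (j + 2))" for m
      unfolding f_def by (simp only: power_mult_distrib power_one_over) simp
    then show ?thesis
      using sums_mult[OF zeta_of_nat_sums[of "j + 2"], of "real (j + 2) ^ n / 2 ^ (j + 2)"]
      by (simp only: Let_def mult_ac times_divide_eq_right times_divide_eq_left le_add2)
  qed
  have ln2: "(\<lambda>m. 1 / (2 * real m + 1) - 1 / (2 * real m + 2)) sums ln 2"
    using alternating_harmonic_series_sums' by (simp add: inverse_eq_divide add_ac)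
  have R: "R sums s"
    unfolding R_def s_def
    by (intro sums_add sums_sum sums_mult ln2 odd_zeta_sums) auto
  have f_nonneg: "f m j \<ge> 0" for m j
    by (simp add: f_def)
  have R_nonneg: "R m \<ge> 0" for m
    by (rule sums_le[OF _ sums_zero row]) (rule f_nonneg)
  have row': "(f m has_sum R m) UNIV" for m
    using row f_nonneg by (simp add: sums_nonneg_imp_has_sum)
  have R': "(R has_sum s) UNIV"
    using R R_nonneg by (simp add: sums_nonneg_imp_has_sum)
  \<comment> \<open>As all terms are nonnegative, convergent rows with summable row sums make the
    double family summable, which justifies exchanging the two sums.\<close>
  have summ: "(\<lambda>(m, j). f m j) summable_on UNIV \<times> UNIV"
    using row' R' f_nonneg by (intro summable_on_SigmaI[where g = R]) (auto simp: has_sum_imp_summable)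
  have "((\<lambda>(m, j). f m j) has_sum s) (UNIV \<times> UNIV)"
    using row' R' summ by (intro has_sum_SigmaI[where g = R]) auto
  then have swapped: "((\<lambda>(j, m). f m j) has_sum s) (UNIV \<times> UNIV)"
    using has_sum_swap[of "\<lambda>(m, j). f m j" UNIV UNIV s] by simp
  have "((\<lambda>m. case (j, m) of (j, m) \<Rightarrow> f m j) has_sum
      (let k = j + 2 in zeta (real k) * real k ^ n / 2 ^ k)) UNIV" for j
    unfolding case_prod_conv by (rule sums_nonneg_imp_has_sum[OF col]) (rule f_nonneg)
  from has_sum_SigmaD[OF swapped this]
  have "((\<lambda>j. let k = j + 2 in zeta (real k) * real k ^ n / 2 ^ k) has_sum s) UNIV" .
  from has_sum_imp_sums[OF this] show ?thesis
    by (simp only: s_def c_def mult.assoc)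
qed

end
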